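(* Let $R=\mathbb{C}[\partial]A\oplus\mathbb{C}[\partial]B$ be a rank two Lie conformal algebra satisfying $[A_\lambda A]=0$, $[B_\lambda A]=a(\lambda)A$ and $[B_\lambda B]=Q(\lambda,\partial)A$, where $a(\lambda)\in\mathbb{C}[\lambda]$ and $Q(\lambda,\partial)\in\mathbb{C}[\lambda,\partial]$. If $a(\lambda)=0$, then $Q(\lambda,\partial)$ may be any skew-symmetric polynomial (i.e. for every skew-symmetric $Q$ these brackets define a Lie conformal algebra). If $a(\lambda)\neq0$, then there is a new basis $\{A,C\}$ of $R$ such that $[A_\lambda A]=[C_\lambda C]=0$ and $[C_\lambda A]=a(\lambda)A$.
   Context: All vector spaces are over $\mathbb{C}$. A Lie conformal algebra is a $\mathbb{C}[\partial]$-module $R$ with a $\mathbb{C}$-linear map $R\otimes R\to\mathbb{C}[\lambda]\otimes R$, $a\otimes b\mapsto[a_\lambda b]$, such that for all $a,b,c\in R$: $[\partial a_\lambda b]=-\lambda[a_\lambda b]$ and $[a_\lambda\partial b]=(\lambda+\partial)[a_\lambda b]$; $[b_\lambda a]=-[a_{-\lambda-\partial}b]$; $[a_\lambda[b_\mu c]]-[b_\mu[a_\lambda c]]=[[a_\lambda b]_{\lambda+\mu}c]$. It has rank two if it is free of rank two as a $\mathbb{C}[\partial]$-module; a basis means a $\mathbb{C}[\partial]$-basis. A polynomial $f(x,y)\in\mathbb{C}[x,y]$ is skew-symmetric if $f(x,y)=-f(-x-y,y)$. *)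

theory Defs
  imports "HOL-Computational_Algebra.Polynomial"
begin

text \<open>
  A \<open>\<complex>[\<partial>]\<close>-module is a \<^locale>\<open>module\<close> over \<^typ>\<open>complex poly\<close>; the element
  \<open>\<partial>\<close> of \<open>\<complex>[\<partial>]\<close> is \<open>[:0, 1:]\<close>. The space \<open>\<complex>[\<lambda>] \<otimes> R\<close> is the type \<open>'r poly\<close> of
  polynomials in \<open>\<lambda>\<close> with coefficients in \<open>R\<close>, on which \<open>\<lambda>\<close> acts as \<open>pCons 0\<close> and a
  linear operator on \<open>R\<close> acts through \<open>map_poly\<close>. The space \<open>\<complex>[\<lambda>,\<mu>] \<otimes> R\<close> is
  \<open>'r poly poly\<close>, with inner variable \<open>\<lambda>\<close> and outer variable \<open>\<mu>\<close>.
\<close>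

text \<open>
  \<open>poly_at \<iota> X f\<close> is \<open>\<Sum>n. X\<^sup>n (\<iota> f\<^sub>n)\<close> for \<open>f = \<Sum>n. \<lambda>\<^sup>n f\<^sub>n\<close>: the substitution of the
  operator \<open>X\<close> for \<open>\<lambda>\<close> after the coefficients have been mapped to the target by \<open>\<iota>\<close>.
\<close>

definition poly_at ::
  "('r::zero \<Rightarrow> 'm::comm_monoid_add) \<Rightarrow> ('m \<Rightarrow> 'm) \<Rightarrow> 'r poly \<Rightarrow> 'm" where
  "poly_at \<iota> X f = (\<Sum>n\<le>degree f. (X ^^ n) (\<iota> (coeff f n)))"

definition mult_lambda :: "'r::zero poly poly \<Rightarrow> 'r poly poly" where
  "mult_lambda = map_poly (pCons 0)"

definition mult_mu :: "'r::zero poly poly \<Rightarrow> 'r poly poly" where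
  "mult_mu = pCons 0"

text \<open>
  \<open>bracket_at br X a b\<close> is \<open>[a\<^sub>X b]\<close> in \<open>\<complex>[\<lambda>,\<mu>] \<otimes> R\<close>, for an operator \<open>X\<close> on that space.
\<close>

definition bracket_at ::
  "('r::comm_monoid_add \<Rightarrow> 'r \<Rightarrow> 'r poly) \<Rightarrow> ('r poly poly \<Rightarrow> 'r poly poly) \<Rightarrow>
   'r \<Rightarrow> 'r \<Rightarrow> 'r poly poly" where
  "bracket_at br X a b = poly_at (\<lambda>x. [:[:x:]:]) X (br a b)"

locale lie_conformal_algebra =
  module scale for scale :: "complex poly \<Rightarrow> 'r::ab_group_add \<Rightarrow> 'r" +
  fixes bracket :: "'r \<Rightarrow> 'r \<Rightarrow> 'r poly"
  assumes bracket_add_left: "bracket (a + b) c = bracket a c + bracket b c"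
    and bracket_add_right: "bracket a (b + c) = bracket a b + bracket a c"
    and bracket_scale_left: "bracket (scale [:z:] a) b = map_poly (scale [:z:]) (bracket a b)"
    and bracket_scale_right: "bracket a (scale [:z:] b) = map_poly (scale [:z:]) (bracket a b)"
    and sesquilinear_left: "bracket (scale [:0, 1:] a) b = - pCons 0 (bracket a b)"
    and sesquilinear_right:
      "bracket a (scale [:0, 1:] b) =
         pCons 0 (bracket a b) + map_poly (scale [:0, 1:]) (bracket a b)"
    and skew_symmetry:
      "bracket b a =
         - poly_at (\<lambda>x. [:x:]) (\<lambda>g. - pCons 0 g - map_poly (scale [:0, 1:]) g) (bracket a b)"
    and jacobi:
      "poly_at (\<lambda>x. bracket_at bracket mult_lambda a x) mult_mu (bracket b c)
         - poly_at (\<lambda>x. bracket_at bracket mult_mu b x) mult_lambda (bracket a c)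
       = poly_at (\<lambda>x. bracket_at bracket (\<lambda>g. mult_lambda g + mult_mu g) x c)
           mult_lambda (bracket a b)"

definition (in module) basis_pair :: "'b \<Rightarrow> 'b \<Rightarrow> bool" where
  "basis_pair x y \<longleftrightarrow> x \<noteq> y \<and> independent {x, y} \<and> span {x, y} = UNIV"

text \<open>
  A polynomial \<open>f(x, y)\<close> is an element of \<open>\<complex>[y][x]\<close>, the outer variable being \<open>x\<close>;
  \<open>f(- x - y, y)\<close> is the composition with \<open>- y - x\<close> in the variable \<open>x\<close>.
\<close>

definition skew_symmetric_poly :: "complex poly poly \<Rightarrow> bool" where
  "skew_symmetric_poly f \<longleftrightarrow> f = - pcompose f [:- [:0, 1:], - 1:]"

text \<open>
  \<open>Q(\<lambda>, \<partial>) x\<close> in \<open>\<complex>[\<lambda>] \<otimes> R\<close>, for \<open>Q\<close> in \<open>\<complex>[\<partial>][\<lambda>]\<close>, and \<open>p(\<lambda>) x\<close> for \<open>p\<close> in \<open>\<complex>[\<lambda>]\<close>.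
\<close>

definition poly2_scale ::
  "(complex poly \<Rightarrow> 'r \<Rightarrow> 'r::zero) \<Rightarrow> complex poly poly \<Rightarrow> 'r \<Rightarrow> 'r poly" where
  "poly2_scale scale Q x = map_poly (\<lambda>p. scale p x) Q"

definition lambda_scale ::
  "(complex poly \<Rightarrow> 'r \<Rightarrow> 'r::zero) \<Rightarrow> complex poly \<Rightarrow> 'r \<Rightarrow> 'r poly" where
  "lambda_scale scale p x = map_poly (\<lambda>c. scale [:c:] x) p"

end

theory Submission
  imports Defs
begin

text \<open>
  A module homomorphism from \<open>R\<close> to \<open>\<complex>\<close>, on which \<open>\<partial>\<close> acts by a number \<open>d\<close>, turns elements of
  \<open>\<complex>[\<lambda>] \<otimes> R\<close> into functions of \<open>\<lambda>\<close>. Composing the coordinates of the basis \<open>A, B\<close> with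
  evaluation at all \<open>d\<close> gives enough such functionals to separate the points of \<open>\<complex>[\<lambda>] \<otimes> R\<close>, and
  evaluation turns each axiom into an identity between polynomial functions. So every equation
  below is checked on numbers. By sesquilinearity a bracket is known once it is known on the basis.

  If \<open>a = 0\<close>, the only candidate is
  \<open>[x\<^sub>\<lambda> y] = x\<^sub>B(-\<lambda>) y\<^sub>B(\<lambda> + \<partial>) Q(\<lambda>, \<partial>) A\<close>, with \<open>x\<^sub>B, y\<^sub>B\<close> the \<open>B\<close>-coordinates. Skew-symmetry of
  the bracket is that of \<open>Q\<close>, and every double bracket vanishes because \<open>A\<close> has \<open>B\<close>-coordinate 0,
  so the Jacobi identity is \<open>0 = 0\<close> (lemma \<open>lie_conformal_algebra_cocycle_bracket\<close>).

  If \<open>a \<noteq> 0\<close>, put \<open>P(x, y) = Q(x, -x-y)\<close>. It is antisymmetric by skew-symmetry, and the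
  Jacobi identity for \<open>B, B, B\<close> becomes, with \<open>x = \<lambda>\<close>, \<open>y = \<mu>\<close>, \<open>z = -\<lambda>-\<mu>-\<partial>\<close>,
  \<open>a(x) P(y, z) - a(y) P(x, z) + a(z) P(x, y) = 0\<close>: the "wedge product" of \<open>a\<close> and \<open>P\<close> vanishes.
  Fixing \<open>z\<close> at a point with \<open>a(z) \<noteq> 0\<close> divides \<open>P\<close> by \<open>a\<close>:
  \<open>P(x, y) = g(x) a(y) - g(y) a(x)\<close> with \<open>g(x) = P(x, z) / a(z)\<close> (lemma \<open>exists_primitive\<close>).
  This says exactly that \<open>C = B + g(-\<partial>) A\<close> satisfies \<open>[C\<^sub>\<lambda> C] = 0\<close>
  (lemma \<open>exists_commuting_complement\<close>).
\<close>

section \<open>Evaluating polynomials with coefficients in a module\<close>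

definition eval_coeffs :: "('r::zero \<Rightarrow> complex) \<Rightarrow> complex \<Rightarrow> 'r poly \<Rightarrow> complex" where
  "eval_coeffs \<phi> l f = poly (map_poly \<phi> f) l"

text \<open>These are the module homomorphisms from \<open>R\<close> to \<open>\<complex>\<close>, the latter being the \<open>\<complex>[\<partial>]\<close>-module
  supported at the point \<open>d\<close>.\<close>

definition point_functional ::
  "(complex poly \<Rightarrow> 'r::ab_group_add \<Rightarrow> 'r) \<Rightarrow> complex \<Rightarrow> ('r \<Rightarrow> complex) \<Rightarrow> bool" where
  "point_functional scale d \<phi> \<longleftrightarrow> additive \<phi> \<and> (\<forall>p x. \<phi> (scale p x) = poly p d * \<phi> x)"

lemma point_functional_additive: "point_functional scale d \<phi> \<Longrightarrow> additive \<phi>"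
  by (simp add: point_functional_def)

lemma point_functional_scale:
  "point_functional scale d \<phi> \<Longrightarrow> \<phi> (scale p x) = poly p d * \<phi> x"
  by (simp add: point_functional_def)

lemma eval_coeffs_0 [simp]: "eval_coeffs \<phi> l 0 = 0"
  by (simp add: eval_coeffs_def)

lemma eval_coeffs_pCons:
  assumes "\<phi> 0 = 0"
  shows "eval_coeffs \<phi> l (pCons x f) = \<phi> x + l * eval_coeffs \<phi> l f"
  using assms by (simp add: eval_coeffs_def map_poly_pCons)

lemma additive_eval_coeffs:
  assumes "additive \<phi>"
  shows "additive (eval_coeffs \<phi> l)"
proof
  fix f g
  have "map_poly \<phi> (f + g) = map_poly \<phi> f + map_poly \<phi> g"
    by (rule poly_eqI) (simp add: coeff_map_poly additive.zero[OF assms] additive.add[OF assms])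
  then show "eval_coeffs \<phi> l (f + g) = eval_coeffs \<phi> l f + eval_coeffs \<phi> l g"
    by (simp add: eval_coeffs_def)
qed

lemma eval_coeffs_mult_mu:
  "eval_coeffs (eval_coeffs \<phi> l) m (mult_mu g) = m * eval_coeffs (eval_coeffs \<phi> l) m g"
  by (simp add: mult_mu_def eval_coeffs_pCons)

lemma eval_coeffs_mult_lambda:
  assumes "additive \<phi>"
  shows "eval_coeffs (eval_coeffs \<phi> l) m (mult_lambda g) = l * eval_coeffs (eval_coeffs \<phi> l) m g"
  unfolding mult_lambda_def
  by (induction g)
     (simp_all add: map_poly_pCons eval_coeffs_pCons additive.zero[OF assms] algebra_simps)

text \<open>A functional that turns the operator \<open>X\<close> into multiplication by \<open>x\<close> turns the substitution of
  \<open>X\<close> into evaluation at \<open>x\<close>; this is what makes the operator substitutions in the axioms computable.\<close>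

lemma functional_poly_at:
  assumes "additive \<Phi>" and X: "\<And>g. \<Phi> (X g) = x * \<Phi> g" and "\<iota> 0 = 0"
  shows "\<Phi> (poly_at \<iota> X f) = eval_coeffs (\<lambda>r. \<Phi> (\<iota> r)) x f"
proof -
  have zero: "\<Phi> (\<iota> 0) = 0" using assms by (simp add: additive.zero)
  have pow: "\<Phi> ((X ^^ n) g) = x ^ n * \<Phi> g" for n g
    by (induction n) (simp_all add: X)
  let ?p = "map_poly (\<lambda>r. \<Phi> (\<iota> r)) f"
  have "poly ?p x = (\<Sum>n\<le>degree ?p. coeff ?p n * x ^ n)" by (simp add: poly_altdef)
  also have "\<dots> = (\<Sum>n\<le>degree f. coeff ?p n * x ^ n)"
    by (rule sum.mono_neutral_left) (auto simp: coeff_eq_0 map_poly_degree_leq)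
  finally show ?thesis
    by (simp add: poly_at_def additive.sum[OF assms(1)] pow eval_coeffs_def
        coeff_map_poly zero mult.commute)
qed

lemma poly_at_zero:
  assumes "\<And>n. \<iota> (coeff f n) = 0" and "X 0 = 0"
  shows "poly_at \<iota> X f = 0"
proof -
  have "(X ^^ n) 0 = 0" for n by (induction n) (simp_all add: assms)
  then show ?thesis by (simp add: poly_at_def assms)
qed

text \<open>A polynomial in \<open>\<lambda>\<close> and \<open>\<mu>\<close> is evaluated by two nested evaluations, the inner one at the value
  \<open>l\<close> of \<open>\<lambda>\<close> and the outer one at the value \<open>m\<close> of \<open>\<mu>\<close>.\<close>

lemma eval_coeffs_bracket_at:
  assumes "additive \<phi>"
    and "\<And>g. eval_coeffs (eval_coeffs \<phi> l) m (X g) = x * eval_coeffs (eval_coeffs \<phi> l) m g"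
  shows "eval_coeffs (eval_coeffs \<phi> l) m (bracket_at br X a b) = eval_coeffs \<phi> x (br a b)"
proof -
  have *: "eval_coeffs (eval_coeffs \<phi> l) m [:[:r:]:] = \<phi> r" for r
    by (simp add: eval_coeffs_pCons additive.zero[OF assms(1)])
  show ?thesis
    unfolding bracket_at_def
    by (subst functional_poly_at[where x = x])
       (use assms in \<open>auto simp: * additive_eval_coeffs\<close>)
qed

lemma bracket_at_0: "br a b = 0 \<Longrightarrow> bracket_at br X a b = 0"
  by (simp add: bracket_at_def poly_at_def)

lemma poly_poly_const: "poly (poly P q) d = poly (poly P [:poly q d:]) d"
  for P :: "complex poly poly"
  by (induction P) simp_all

lemma eval_lift: "poly (poly (map_poly (\<lambda>c. [:c:]) p) q) d = poly p (poly q d)"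
  for p q :: "complex poly"
  by (induction p) (simp_all add: map_poly_pCons)

lemma skew_symmetric_poly_eval:
  assumes "skew_symmetric_poly Q"
  shows "poly (poly Q [:l:]) d = - poly (poly Q [:- l - d:]) d"
proof -
  have "poly (poly Q [:l:]) d = poly (poly (- pcompose Q [:- [:0, 1:], - 1:]) [:l:]) d"
    using assms by (simp add: skew_symmetric_poly_def)
  also have "\<dots> = - poly (poly Q [:- l - d:]) d"
    by (simp add: poly_pcompose poly_poly_const[of Q "[:- l, - 1:]"])
  finally show ?thesis .
qed

context module
begin

lemma independent_pairI:
  assumes "\<And>p q. scale p x + scale q y = 0 \<Longrightarrow> p = 0 \<and> q = 0"
  shows "independent {x, y}"
proof -
  have "x \<noteq> y"
    using assms[of 1 "-1"] by auto
  moreover have "u x = 0 \<and> u y = 0" if "scale (u x) x + scale (u y) y = 0" for u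
    using assms that by simp
  ultimately show ?thesis
    by (subst dependent_finite) auto
qed

end

context
  fixes scale :: "complex poly \<Rightarrow> 'r::ab_group_add \<Rightarrow> 'r"
  assumes module: "module scale"
begin

interpretation module scale by (rule module)

lemma eval_coeffs_map_scale:
  assumes "point_functional scale d \<phi>"
  shows "eval_coeffs \<phi> l (map_poly (scale p) f) = poly p d * eval_coeffs \<phi> l f"
  using point_functional_scale[OF assms] additive.zero[OF point_functional_additive[OF assms]]
  by (induction f) (simp_all add: map_poly_pCons eval_coeffs_pCons algebra_simps)

text \<open>In the Jacobi identity \<open>\<phi>\<close> is the evaluation of a bracket with the argument in one slot, and \<open>d\<close> is
  the shifted value \<open>l + d'\<close> or \<open>-l\<close> at which sesquilinearity evaluates the scalars of that slot.\<close>

lemma eval_coeffs_poly2_scale: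
  assumes "\<And>p. \<phi> (scale p x) = poly p d * \<phi> x"
  shows "eval_coeffs \<phi> l (poly2_scale scale Q x) = poly (poly Q [:l:]) d * \<phi> x"
proof -
  have "\<phi> 0 = 0" using assms[of 0] by simp
  then show ?thesis
    unfolding poly2_scale_def
    by (induction Q) (simp_all add: map_poly_pCons eval_coeffs_pCons assms algebra_simps)
qed

lemma eval_coeffs_lambda_scale:
  assumes "point_functional scale d \<phi>"
  shows "eval_coeffs \<phi> l (lambda_scale scale p x) = poly p l * \<phi> x"
  unfolding lambda_scale_def
  using point_functional_scale[OF assms] additive.zero[OF point_functional_additive[OF assms]]
  by (induction p) (simp_all add: map_poly_pCons eval_coeffs_pCons algebra_simps)

end

section \<open>The axioms of a Lie conformal algebra after evaluation\<close>

context lie_conformal_algebra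
begin

lemma bracket_0_left [simp]: "bracket 0 b = 0"
  using bracket_add_left[of 0 0 b] by simp

lemma bracket_0_right [simp]: "bracket a 0 = 0"
  using bracket_add_right[of a 0 0] by simp

text \<open>Sesquilinearity extends from \<open>\<partial>\<close> to \<open>\<complex>[\<partial>]\<close>: a scalar \<open>p(\<partial>)\<close> leaves the first slot as \<open>p(-\<lambda>)\<close> and
  the second one as \<open>p(\<lambda> + \<partial>)\<close>.\<close>

lemma eval_bracket_scale_left:
  assumes "point_functional scale d \<phi>"
  shows "eval_coeffs \<phi> l (bracket (scale p a) b) = poly p (- l) * eval_coeffs \<phi> l (bracket a b)"
proof (induction p)
  case 0
  then show ?case by simp
next
  case (pCons c p)
  note add = additive_eval_coeffs[OF point_functional_additive[OF assms]]
  note zero = additive.zero[OF point_functional_additive[OF assms]]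
  have "scale (pCons c p) a = scale [:c:] a + scale [:0, 1:] (scale p a)"
    by (simp flip: scale_left_distrib)
  then show ?case
    using pCons.IH
    by (simp del: scale_scale add: bracket_add_left bracket_scale_left sesquilinear_left
        additive.add[OF add] additive.minus[OF add] eval_coeffs_pCons zero algebra_simps
        eval_coeffs_map_scale[OF module_axioms assms])
qed

lemma eval_bracket_scale_right:
  assumes "point_functional scale d \<phi>"
  shows "eval_coeffs \<phi> l (bracket a (scale p b)) = poly p (l + d) * eval_coeffs \<phi> l (bracket a b)"
proof (induction p)
  case 0
  then show ?case by simp
next
  case (pCons c p)
  note add = additive_eval_coeffs[OF point_functional_additive[OF assms]]
  note zero = additive.zero[OF point_functional_additive[OF assms]]
  have "scale (pCons c p) b = scale [:c:] b + scale [:0, 1:] (scale p b)"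
    by (simp flip: scale_left_distrib)
  then show ?case
    using pCons.IH
    by (simp del: scale_scale add: bracket_add_right bracket_scale_right sesquilinear_right
        additive.add[OF add] eval_coeffs_pCons zero algebra_simps
        eval_coeffs_map_scale[OF module_axioms assms])
qed

lemma eval_skew_symmetry:
  assumes "point_functional scale d \<phi>"
  shows "eval_coeffs \<phi> l (bracket b a) = - eval_coeffs \<phi> (- l - d) (bracket a b)"
proof -
  note add = additive_eval_coeffs[OF point_functional_additive[OF assms]]
  note zero = additive.zero[OF point_functional_additive[OF assms]]
  show ?thesis
    by (subst skew_symmetry[of b a], subst additive.minus[OF add],
        subst functional_poly_at[where x = "- l - d"])
       (simp_all add: add zero additive.minus[OF add] additive.diff[OF add] eval_coeffs_pCons
        eval_coeffs_map_scale[OF module_axioms assms] algebra_simps)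
qed

text \<open>The outermost parameter of the three iterated brackets becomes \<open>l\<close>, \<open>m\<close> and \<open>l + m\<close>, so each term
  is an ordinary evaluation of one bracket nested in that of another.\<close>

lemma eval_jacobi:
  assumes "additive \<phi>"
  shows "eval_coeffs (\<lambda>x. eval_coeffs \<phi> l (bracket a x)) m (bracket b c)
      - eval_coeffs (\<lambda>x. eval_coeffs \<phi> m (bracket b x)) l (bracket a c)
    = eval_coeffs (\<lambda>x. eval_coeffs \<phi> (l + m) (bracket x c)) l (bracket a b)"
proof -
  let ?E = "eval_coeffs (eval_coeffs \<phi> l) m"
  have add: "additive ?E" by (intro additive_eval_coeffs assms)
  note mult = eval_coeffs_mult_lambda[OF assms] eval_coeffs_mult_mu[of \<phi> l m]
  have "?E (poly_at (\<lambda>x. bracket_at bracket mult_lambda a x) mult_mu (bracket b c))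
      = eval_coeffs (\<lambda>x. eval_coeffs \<phi> l (bracket a x)) m (bracket b c)"
    by (subst functional_poly_at[OF add mult(2)])
       (simp_all add: bracket_at_0 eval_coeffs_bracket_at[OF assms mult(1)])
  moreover have "?E (poly_at (\<lambda>x. bracket_at bracket mult_mu b x) mult_lambda (bracket a c))
      = eval_coeffs (\<lambda>x. eval_coeffs \<phi> m (bracket b x)) l (bracket a c)"
    by (subst functional_poly_at[OF add mult(1)])
       (simp_all add: bracket_at_0 eval_coeffs_bracket_at[OF assms mult(2)])
  moreover have sum: "?E (mult_lambda g + mult_mu g) = (l + m) * ?E g" for g
    by (simp add: additive.add[OF add] mult algebra_simps)
  have "?E (poly_at (\<lambda>x. bracket_at bracket (\<lambda>g. mult_lambda g + mult_mu g) x c)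
            mult_lambda (bracket a b))
      = eval_coeffs (\<lambda>x. eval_coeffs \<phi> (l + m) (bracket x c)) l (bracket a b)"
    by (subst functional_poly_at[OF add mult(1)])
       (simp_all add: bracket_at_0 eval_coeffs_bracket_at[OF assms sum])
  ultimately show ?thesis
    using arg_cong[OF jacobi, of ?E a b c] by (simp add: additive.diff[OF add])
qed

end

section \<open>Coordinates on a free module of rank two\<close>

locale rank_two_module =
  module scale for scale :: "complex poly \<Rightarrow> 'r::ab_group_add \<Rightarrow> 'r" +
  fixes A B :: 'r
  assumes basis: "basis_pair A B"
begin

abbreviation coord :: "'r \<Rightarrow> 'r \<Rightarrow> complex poly" where
  "coord e x \<equiv> representation {A, B} x e"

lemma A_neq_B: "A \<noteq> B" and independent_AB: "independent {A, B}" and span_AB: "span {A, B} = UNIV"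
  using basis by (auto simp: basis_pair_def)

lemma coord_add: "coord e (x + y) = coord e x + coord e y"
  by (simp add: representation_add independent_AB span_AB)

lemma coord_scale: "coord e (scale p x) = p * coord e x"
  by (simp add: representation_scale independent_AB span_AB)

lemma coord_basis [simp]: "coord A A = 1" "coord A B = 0" "coord B A = 0" "coord B B = 1"
  using A_neq_B by (simp_all add: representation_basis independent_AB)

lemma coord_expansion: "x = scale (coord A x) A + scale (coord B x) B"
  using sum_representation_eq[of "{A, B}" x "{A, B}"] A_neq_B
  by (simp add: independent_AB span_AB)

lemma point_functional_coord: "point_functional scale d (\<lambda>x. poly (coord e x) d)"
  by (simp add: point_functional_def additive_def coord_add coord_scale)

text \<open>Polynomials over \<open>\<complex>\<close> are determined by their values. Applied to the variable \<open>\<lambda>\<close> and then to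
  the variable \<open>\<partial>\<close> of the coordinates, this reduces equations in \<open>\<complex>[\<lambda>] \<otimes> R\<close> to equations of
  numbers.\<close>

lemma eval_coeffs_separate:
  assumes "\<And>d \<phi> l. point_functional scale d \<phi> \<Longrightarrow> eval_coeffs \<phi> l f = eval_coeffs \<phi> l g"
  shows "f = g"
proof (rule poly_eqI)
  fix n
  have "coord e (coeff f n) = coord e (coeff g n)" for e
  proof (rule poly_ext)
    fix d
    let ?\<phi> = "\<lambda>x. poly (coord e x) d"
    have "poly (map_poly ?\<phi> f) = poly (map_poly ?\<phi> g)"
      using assms[OF point_functional_coord] by (auto simp: eval_coeffs_def)
    then have "coeff (map_poly ?\<phi> f) n = coeff (map_poly ?\<phi> g) n"
      by (simp add: poly_eq_poly_eq_iff)
    then show "poly (coord e (coeff f n)) d = poly (coord e (coeff g n)) d"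
      by (simp add: coeff_map_poly representation_zero)
  qed
  then show "coeff f n = coeff g n"
    using coord_expansion[of "coeff f n"] coord_expansion[of "coeff g n"] by simp
qed

lemma basis_pair_shear: "basis_pair A (B + scale f A)"
proof -
  have ind: "p = 0 \<and> q = 0" if "scale p A + scale q (B + scale f A) = 0" for p q
  proof -
    have "coord e (scale p A + scale q (B + scale f A)) = 0" for e
      by (simp add: that representation_zero)
    from this[of A] this[of B] show ?thesis by (simp add: coord_add coord_scale)
  qed
  have "x \<in> span {A, B + scale f A}" for x
  proof -
    have "x = scale (coord A x - coord B x * f) A + scale (coord B x) (B + scale f A)"
      by (subst coord_expansion[of x]) (simp add: scale_right_distrib scale_left_diff_distrib)
    then show ?thesis by (metis span_add span_scale span_base insertI1 insertI2)
  qed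
  moreover have "A \<noteq> B + scale f A"
  proof
    assume "A = B + scale f A"
    then have "coord B A = coord B (B + scale f A)" by metis
    then show False by (simp add: coord_add coord_scale)
  qed
  ultimately show ?thesis
    using independent_pairI[OF ind] by (auto simp: basis_pair_def)
qed

section \<open>The case \<open>a = 0\<close>\<close>

text \<open>The value on \<open>(A, B)\<close> follows from that on \<open>(B, A)\<close> by skew-symmetry, and the values on all
  multiples of basis elements by sesquilinearity.\<close>

lemma bracket_unique:
  assumes "lie_conformal_algebra scale br" and "lie_conformal_algebra scale br'"
    and AA: "br A A = br' A A" and BA: "br B A = br' B A" and BB: "br B B = br' B B"
  shows "br = br'"
proof (intro ext, rule eval_coeffs_separate)
  interpret L: lie_conformal_algebra scale br by fact
  interpret L': lie_conformal_algebra scale br' by fact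
  fix x y d \<phi> l
  assume \<phi>: "point_functional scale d \<phi>"
  note add = additive.add[OF additive_eval_coeffs[OF point_functional_additive[OF \<phi>]]]
  have AB: "eval_coeffs \<phi> l (br A B) = eval_coeffs \<phi> l (br' A B)"
    by (simp add: L.eval_skew_symmetry[OF \<phi>, of _ A B] L'.eval_skew_symmetry[OF \<phi>, of _ A B] BA)
  show "eval_coeffs \<phi> l (br x y) = eval_coeffs \<phi> l (br' x y)"
    by (subst (1 2) coord_expansion[of x], subst (1 2) coord_expansion[of y])
       (simp add: L.bracket_add_left L.bracket_add_right L'.bracket_add_left L'.bracket_add_right
         add L.eval_bracket_scale_left[OF \<phi>] L.eval_bracket_scale_right[OF \<phi>]
         L'.eval_bracket_scale_left[OF \<phi>] L'.eval_bracket_scale_right[OF \<phi>] AA BA BB AB)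
qed

text \<open>The argument of \<open>poly2_scale\<close> is \<open>x\<^sub>B(-\<lambda>) y\<^sub>B(\<lambda> + \<partial>) Q(\<lambda>, \<partial>)\<close>: the extension, forced by
  sesquilinearity, of the bracket with \<open>Q(\<lambda>, \<partial>) A\<close> on \<open>(B, B)\<close> and 0 on the other pairs of basis
  elements. It is the abelian extension of \<open>\<complex>[\<partial>]B\<close> by \<open>\<complex>[\<partial>]A\<close> with cocycle \<open>Q\<close>.\<close>

definition cocycle_bracket :: "complex poly poly \<Rightarrow> 'r \<Rightarrow> 'r \<Rightarrow> 'r poly" where
  "cocycle_bracket Q x y = poly2_scale scale
     (pcompose (map_poly (\<lambda>c. [:c:]) (coord B x)) [:0, - 1:] *
      pcompose (map_poly (\<lambda>c. [:c:]) (coord B y)) [:[:0, 1:], 1:] * Q) A"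

lemma eval_cocycle_bracket:
  assumes "point_functional scale d \<phi>"
  shows "eval_coeffs \<phi> l (cocycle_bracket Q x y)
    = poly (coord B x) (- l) * poly (coord B y) (l + d) * poly (poly Q [:l:]) d * \<phi> A"
  unfolding cocycle_bracket_def
  by (simp add: eval_coeffs_poly2_scale[OF module_axioms point_functional_scale[OF assms]]
      poly_pcompose eval_lift add.commute)

lemma cocycle_bracket_eq_0:
  assumes "coord B x = 0 \<or> coord B y = 0"
  shows "cocycle_bracket Q x y = 0"
  using assms by (auto simp: cocycle_bracket_def poly2_scale_def)

lemma coord_B_coeff_cocycle_bracket: "coord B (coeff (cocycle_bracket Q x y) n) = 0"
  by (simp add: cocycle_bracket_def poly2_scale_def coeff_map_poly coord_scale)

lemma lie_conformal_algebra_cocycle_bracket: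
  assumes "skew_symmetric_poly Q"
  shows "lie_conformal_algebra scale (cocycle_bracket Q)"
proof
  let ?br = "cocycle_bracket Q"
  note ev = eval_cocycle_bracket
  have add: "additive (eval_coeffs \<phi> l)" and zero: "\<phi> 0 = 0"
    if "point_functional scale d \<phi>" for \<phi> l d
    using that additive_eval_coeffs point_functional_additive additive.zero by blast+
  fix a b c :: 'r and z :: complex
  show "?br (a + b) c = ?br a c + ?br b c"
    by (rule eval_coeffs_separate)
       (simp add: ev additive.add[OF add] coord_add algebra_simps)
  show "?br a (b + c) = ?br a b + ?br a c"
    by (rule eval_coeffs_separate)
       (simp add: ev additive.add[OF add] coord_add algebra_simps)
  show "?br (scale [:z:] a) b = map_poly (scale [:z:]) (?br a b)"
    by (rule eval_coeffs_separate)
       (simp add: ev eval_coeffs_map_scale[OF module_axioms] coord_scale)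
  show "?br a (scale [:z:] b) = map_poly (scale [:z:]) (?br a b)"
    by (rule eval_coeffs_separate)
       (simp add: ev eval_coeffs_map_scale[OF module_axioms] coord_scale)
  show "?br (scale [:0, 1:] a) b = - pCons 0 (?br a b)"
    by (rule eval_coeffs_separate)
       (simp add: ev eval_coeffs_pCons zero additive.minus[OF add] coord_scale)
  show "?br a (scale [:0, 1:] b) = pCons 0 (?br a b) + map_poly (scale [:0, 1:]) (?br a b)"
    by (rule eval_coeffs_separate)
       (simp add: ev eval_coeffs_pCons zero additive.add[OF add] coord_scale
         eval_coeffs_map_scale[OF module_axioms] algebra_simps)
  show "?br b a = - poly_at (\<lambda>x. [:x:]) (\<lambda>g. - pCons 0 g - map_poly (scale [:0, 1:]) g) (?br a b)"
  proof (rule eval_coeffs_separate)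
    fix d \<phi> l
    assume \<phi>: "point_functional scale d \<phi>"
    have "eval_coeffs \<phi> l
        (poly_at (\<lambda>x. [:x:]) (\<lambda>g. - pCons 0 g - map_poly (scale [:0, 1:]) g) (?br a b))
      = eval_coeffs \<phi> (- l - d) (?br a b)"
      by (subst functional_poly_at[where x = "- l - d"])
         (simp_all add: add[OF \<phi>] zero[OF \<phi>] additive.minus[OF add[OF \<phi>]]
          additive.diff[OF add[OF \<phi>]] eval_coeffs_pCons
          eval_coeffs_map_scale[OF module_axioms \<phi>] algebra_simps)
    then show "eval_coeffs \<phi> l (?br b a) = eval_coeffs \<phi> l
        (- poly_at (\<lambda>x. [:x:]) (\<lambda>g. - pCons 0 g - map_poly (scale [:0, 1:]) g) (?br a b))"
      using skew_symmetric_poly_eval[OF assms, of l d]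
      by (simp add: ev[OF \<phi>] additive.minus[OF add[OF \<phi>]] add.commute)
  qed
  (* All coefficients of inner brackets are multiples of A, on which the bracket vanishes. *)
  show "poly_at (\<lambda>x. bracket_at ?br mult_lambda a x) mult_mu (?br b c)
       - poly_at (\<lambda>x. bracket_at ?br mult_mu b x) mult_lambda (?br a c)
     = poly_at (\<lambda>x. bracket_at ?br (\<lambda>g. mult_lambda g + mult_mu g) x c) mult_lambda (?br a b)"
    by (simp add: poly_at_zero bracket_at_0 cocycle_bracket_eq_0 coord_B_coeff_cocycle_bracket
        mult_lambda_def mult_mu_def)
qed

lemma unique_bracket_zero_action:
  assumes "skew_symmetric_poly Q"
  shows "\<exists>!br. lie_conformal_algebra scale br
    \<and> br A A = 0 \<and> br B A = 0 \<and> br B B = poly2_scale scale Q A"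
proof (rule ex1I[of _ "cocycle_bracket Q"])
  have "cocycle_bracket Q B B = poly2_scale scale Q A"
    by (simp add: cocycle_bracket_def map_poly_1' pcompose_1)
  then show *: "lie_conformal_algebra scale (cocycle_bracket Q)
      \<and> cocycle_bracket Q A A = 0 \<and> cocycle_bracket Q B A = 0
      \<and> cocycle_bracket Q B B = poly2_scale scale Q A"
    by (simp add: lie_conformal_algebra_cocycle_bracket[OF assms] cocycle_bracket_eq_0)
  show "br = cocycle_bracket Q" if "lie_conformal_algebra scale br
      \<and> br A A = 0 \<and> br B A = 0 \<and> br B B = poly2_scale scale Q A" for br
    using bracket_unique[of br "cocycle_bracket Q"] * that by simp
qed

section \<open>The case \<open>a \<noteq> 0\<close>\<close>

text \<open>The \<open>A\<close>-coordinate at \<open>\<partial> = d\<close> of the Jacobi identity for \<open>B, B, B\<close>. The inner bracket is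
  a multiple \<open>q(\<partial>) A\<close>, and \<open>q(\<partial>)\<close> leaves the outer bracket as \<open>q(\<lambda> + d)\<close> from the right slot and
  as \<open>q(-\<lambda> - \<mu>)\<close> from the left slot of a bracket with parameter \<open>\<lambda> + \<mu>\<close>.\<close>

lemma jacobi_BBB:
  assumes "lie_conformal_algebra scale br"
    and BA: "br B A = lambda_scale scale a A" and BB: "br B B = poly2_scale scale Q A"
  shows "poly (poly Q [:m:]) (l + d) * poly a l - poly (poly Q [:l:]) (m + d) * poly a m
    = - poly (poly Q [:l:]) (- l - m) * poly a (- l - m - d)"
proof -
  interpret L: lie_conformal_algebra scale br by fact
  let ?\<phi> = "\<lambda>x. poly (coord A x) d"
  have \<phi>: "point_functional scale d ?\<phi>" by (rule point_functional_coord)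
  have A: "eval_coeffs ?\<phi> x (br B A) = poly a x" "eval_coeffs ?\<phi> x (br A B) = - poly a (- x - d)"
    for x
    by (simp_all add: L.eval_skew_symmetry[OF \<phi>, of _ A B] BA
        eval_coeffs_lambda_scale[OF module_axioms \<phi>])
  note nested = eval_coeffs_poly2_scale[OF module_axioms]
  have 1: "eval_coeffs (\<lambda>x. eval_coeffs ?\<phi> u (br B x)) v (br B B)
      = poly (poly Q [:v:]) (u + d) * poly a u" for u v
    unfolding BB by (subst nested[where d = "u + d"])
      (simp_all add: L.eval_bracket_scale_right[OF \<phi>] A)
  have 2: "eval_coeffs (\<lambda>x. eval_coeffs ?\<phi> (l + m) (br x B)) l (br B B)
      = poly (poly Q [:l:]) (- l - m) * - poly a (- l - m - d)"
    unfolding BB by (subst nested[where d = "- l - m"])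
      (simp_all add: L.eval_bracket_scale_left[OF \<phi>] A)
  show ?thesis
    using L.eval_jacobi[OF point_functional_additive[OF \<phi>], of l B m B B] by (simp add: 1 2)
qed

text \<open>In the coordinates \<open>x = \<lambda>\<close>, \<open>y = -\<lambda>-\<partial>\<close> the right-hand side is \<open>f(-x) a(y) - f(-y) a(x)\<close>, so
  the claim is that the antisymmetric \<open>P(x, y) = Q(x, -x-y)\<close> is a "wedge product" of \<open>a\<close> with
  some polynomial in one variable. In a linear-algebra picture, \<open>a \<and> P = 0\<close> with \<open>a \<noteq> 0\<close> makes \<open>P\<close> a
  multiple of \<open>a\<close>, and contraction with the evaluation functional at a point where \<open>a \<noteq> 0\<close>
  provides the other factor.\<close>

lemma exists_primitive:
  assumes "lie_conformal_algebra scale br"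
    and "br B A = lambda_scale scale a A" and "br B B = poly2_scale scale Q A"
    and "a \<noteq> 0"
  obtains f where "\<And>l d. poly (poly Q [:l:]) d
    = poly f (- l) * poly a (- l - d) - poly f (l + d) * poly a l"
proof -
  obtain z where z: "poly a z \<noteq> 0"
    using \<open>a \<noteq> 0\<close> by (meson poly_all_0_iff_0)
  (* f(t) = Q(-t, t - z) / a(z), that is P(-t, z) / a(z) *)
  define f where "f = smult (1 / poly a z) (pcompose (poly Q [:- z, - 1:]) [:- z, 1:])"
  have f: "poly a z * poly f t = poly (poly Q [:- t:]) (t - z)" for t
    using z by (simp add: f_def poly_pcompose poly_poly_const[of Q "[:- z, - 1:]"])
  have "poly (poly Q [:l:]) d = poly f (- l) * poly a (- l - d) - poly f (l + d) * poly a l"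
    for l d
  proof -
    (* These values of m and of the \<partial>-variable give the third argument - l - m - (d - z) the value z. *)
    have "poly a z * poly (poly Q [:l:]) d = poly a (- l - d) * poly (poly Q [:l:]) (- l - z)
        - poly a l * poly (poly Q [:- l - d:]) (l + d - z)"
      using jacobi_BBB[OF assms(1-3), where l = l and m = "- l - d" and d = "d - z"]
      by (simp add: algebra_simps)
    also have "\<dots> = poly a z * (poly f (- l) * poly a (- l - d) - poly f (l + d) * poly a l)"
    proof -
      have "poly a z * poly f (- l) = poly (poly Q [:l:]) (- l - z)"
        using f[of "- l"] by simp
      moreover have "poly a z * poly f (l + d) = poly (poly Q [:- l - d:]) (l + d - z)"
        using f[of "l + d"] by simp
      ultimately show ?thesis
        by (simp only: right_diff_distrib flip: mult.assoc) (simp only: mult.commute)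
    qed
    finally show ?thesis using z by simp
  qed
  then show ?thesis by (rule that)
qed

lemma exists_commuting_complement:
  assumes "lie_conformal_algebra scale br"
    and AA: "br A A = 0" and BA: "br B A = lambda_scale scale a A"
    and BB: "br B B = poly2_scale scale Q A" and "a \<noteq> 0"
  shows "\<exists>C. basis_pair A C \<and> br A A = 0 \<and> br C C = 0 \<and> br C A = lambda_scale scale a A"
proof -
  interpret L: lie_conformal_algebra scale br by fact
  obtain f where f: "\<And>l d. poly (poly Q [:l:]) d
      = poly f (- l) * poly a (- l - d) - poly f (l + d) * poly a l"
    using exists_primitive[OF assms(1) BA BB \<open>a \<noteq> 0\<close>] by blast
  let ?C = "B + scale f A"
  (* [C_l C] = Q(l,d) A + f(l+d) [B_l A] + f(-l) [A_l B], where [A_l B] = -a(-l-d) A by skew-symmetry *)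
  have "br ?C ?C = 0"
  proof (rule eval_coeffs_separate)
    fix d \<phi> l
    assume \<phi>: "point_functional scale d \<phi>"
    note add = additive.add[OF additive_eval_coeffs[OF point_functional_additive[OF \<phi>]]]
    show "eval_coeffs \<phi> l (br ?C ?C) = eval_coeffs \<phi> l 0"
      by (simp add: L.bracket_add_left L.bracket_add_right add AA BA BB f
          L.eval_bracket_scale_left[OF \<phi>] L.eval_bracket_scale_right[OF \<phi>]
          L.eval_skew_symmetry[OF \<phi>, of _ A B] eval_coeffs_lambda_scale[OF module_axioms \<phi>]
          eval_coeffs_poly2_scale[OF module_axioms point_functional_scale[OF \<phi>]] algebra_simps)
  qed
  moreover have "br (scale f A) A = 0"
    by (rule eval_coeffs_separate) (simp add: L.eval_bracket_scale_left AA)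
  then have "br ?C A = lambda_scale scale a A"
    by (simp add: L.bracket_add_left BA)
  ultimately show ?thesis
    using basis_pair_shear[of f] AA by blast
qed

end

theorem proposition2p3:
  fixes scale :: "complex poly \<Rightarrow> 'r::ab_group_add \<Rightarrow> 'r"
    and A B :: 'r
  assumes "module scale"
    and "module.basis_pair scale A B"
  shows "(\<forall>Q. skew_symmetric_poly Q \<longrightarrow>
            (\<exists>!bracket. lie_conformal_algebra scale bracket
               \<and> bracket A A = 0 \<and> bracket B A = 0 \<and> bracket B B = poly2_scale scale Q A))
       \<and> (\<forall>bracket a Q. lie_conformal_algebra scale bracket
            \<and> bracket A A = 0 \<and> bracket B A = lambda_scale scale a A
            \<and> bracket B B = poly2_scale scale Q A \<and> a \<noteq> 0 \<longrightarrow>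
            (\<exists>C. module.basis_pair scale A C
               \<and> bracket A A = 0 \<and> bracket C C = 0 \<and> bracket C A = lambda_scale scale a A))"
proof -
  interpret rank_two_module scale A B
    using assms by (simp add: rank_two_module_def rank_two_module_axioms_def)
  show ?thesis
    using unique_bracket_zero_action exists_commuting_complement by blast
qed

end
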